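(* Let $I>0$, $T_k>0$, and let real numbers $\sigma_k,p_{\sigma_k},\sigma_{k+1},p_{\sigma_{k+1}}$ be given. Among all controls $\tau$ on $[0,T_k]$ for which the solution of $$\dot\sigma=\frac{p_\sigma}{I},\qquad \dot p_\sigma=\tau,\qquad (\sigma,p_\sigma)(0)=(\sigma_k,p_{\sigma_k})$$ satisfies $(\sigma,p_\sigma)(T_k)=(\sigma_{k+1},p_{\sigma_{k+1}})$, the cost $\int_0^{T_k}\tau^2(t)\,dt$ is minimized by $$\tau_k(t)=\frac12\Big(A_{2_k}-\frac{A_{1_k}}{I}t\Big),\qquad t\in[0,T_k],$$ where $$A_{1_k}=\frac{24I^2}{T_k^3}(\sigma_{k+1}-\sigma_k)-\frac{12I}{T_k^2}(p_{\sigma_{k+1}}+p_{\sigma_k}),$$ $$A_{2_k}=\frac{12I}{T_k^2}(\sigma_{k+1}-\sigma_k)-\frac{4}{T_k}p_{\sigma_{k+1}}-\frac{8}{T_k}p_{\sigma_k}.$$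
   Context: $\sigma$ is the orientation of a planar rigid body, $p_\sigma$ its angular momentum, $I$ its moment of inertia, $\tau$ the applied torque, and $T_k$ the duration of the $k$th stance. Controls $\tau$ are taken to be square-integrable functions on $[0,T_k]$. *)

theory Defs
  imports "HOL-Analysis.Analysis"
begin

text \<open>Absolute continuity on an interval. A division of its own union is a finite family of
  nonempty compact intervals with pairwise disjoint interiors; degenerate members contribute
  nothing to either sum.\<close>

definition absolutely_continuous_on_interval ::
    "real \<Rightarrow> real \<Rightarrow> (real \<Rightarrow> real) \<Rightarrow> bool" where
  "absolutely_continuous_on_interval a b f \<longleftrightarrow>
     (\<forall>\<epsilon>>0. \<exists>\<delta>>0. \<forall>\<D>.
        \<D> division_of \<Union>\<D> \<and> \<Union>\<D> \<subseteq> {a..b} \<and> (\<Sum>K\<in>\<D>. Sup K - Inf K) < \<delta> \<longrightarrow>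
        (\<Sum>K\<in>\<D>. \<bar>f (Sup K) - f (Inf K)\<bar>) < \<epsilon>)"

definition square_integrable_control :: "real \<Rightarrow> (real \<Rightarrow> real) \<Rightarrow> bool" where
  "square_integrable_control T \<tau> \<longleftrightarrow>
     \<tau> \<in> borel_measurable (lebesgue_on {0..T}) \<and>
     integrable (lebesgue_on {0..T}) (\<lambda>t. (\<tau> t)\<^sup>2)"

text \<open>For a merely square-integrable torque, a solution is understood in the Caratheodory sense:
  absolutely continuous, with the differential equations holding almost everywhere.
  On the interval from 0 to T such a solution exists and is unique, so the existential
  quantifier in the admissibility condition below refers to \<^emph>\<open>the\<close> solution.\<close>

definition body_solution ::
    "real \<Rightarrow> real \<Rightarrow> (real \<Rightarrow> real) \<Rightarrow> real \<times> real \<Rightarrow>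
     (real \<Rightarrow> real) \<Rightarrow> (real \<Rightarrow> real) \<Rightarrow> bool" where
  "body_solution I T \<tau> x\<^sub>0 \<sigma> p \<longleftrightarrow>
     absolutely_continuous_on_interval 0 T \<sigma> \<and>
     absolutely_continuous_on_interval 0 T p \<and>
     (AE t in lebesgue_on {0..T}.
        (\<sigma> has_real_derivative p t / I) (at t within {0..T}) \<and>
        (p has_real_derivative \<tau> t) (at t within {0..T})) \<and>
     (\<sigma> 0, p 0) = x\<^sub>0"

definition admissible_control ::
    "real \<Rightarrow> real \<Rightarrow> real \<times> real \<Rightarrow> real \<times> real \<Rightarrow> (real \<Rightarrow> real) \<Rightarrow> bool" where
  "admissible_control I T x\<^sub>0 x\<^sub>1 \<tau> \<longleftrightarrow>
     square_integrable_control T \<tau> \<and>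
     (\<exists>\<sigma> p. body_solution I T \<tau> x\<^sub>0 \<sigma> p \<and> (\<sigma> T, p T) = x\<^sub>1)"

definition control_cost :: "real \<Rightarrow> (real \<Rightarrow> real) \<Rightarrow> real" where
  "control_cost T \<tau> = (LINT t|lebesgue_on {0..T}. (\<tau> t)\<^sup>2)"

definition stance_A1 :: "real \<Rightarrow> real \<Rightarrow> real \<Rightarrow> real \<Rightarrow> real \<Rightarrow> real \<Rightarrow> real" where
  "stance_A1 I T \<sigma>\<^sub>0 p\<^sub>0 \<sigma>\<^sub>1 p\<^sub>1 =
     24 * I\<^sup>2 / T ^ 3 * (\<sigma>\<^sub>1 - \<sigma>\<^sub>0) - 12 * I / T\<^sup>2 * (p\<^sub>1 + p\<^sub>0)"

definition stance_A2 :: "real \<Rightarrow> real \<Rightarrow> real \<Rightarrow> real \<Rightarrow> real \<Rightarrow> real \<Rightarrow> real" where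
  "stance_A2 I T \<sigma>\<^sub>0 p\<^sub>0 \<sigma>\<^sub>1 p\<^sub>1 =
     12 * I / T\<^sup>2 * (\<sigma>\<^sub>1 - \<sigma>\<^sub>0) - 4 / T * p\<^sub>1 - 8 / T * p\<^sub>0"

definition stance_torque ::
    "real \<Rightarrow> real \<Rightarrow> real \<Rightarrow> real \<Rightarrow> real \<Rightarrow> real \<Rightarrow> real \<Rightarrow> real" where
  "stance_torque I T \<sigma>\<^sub>0 p\<^sub>0 \<sigma>\<^sub>1 p\<^sub>1 t =
     1 / 2 * (stance_A2 I T \<sigma>\<^sub>0 p\<^sub>0 \<sigma>\<^sub>1 p\<^sub>1 - stance_A1 I T \<sigma>\<^sub>0 p\<^sub>0 \<sigma>\<^sub>1 p\<^sub>1 / I * t)"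

end

(* Along every trajectory the function (a + b t) p - b I sigma has derivative (a + b t) tau
   almost everywhere, so the fundamental theorem of calculus for absolutely continuous functions
   determines the integral of (a + b t) tau from the boundary data alone.  Hence an affine
   admissible control is orthogonal in L2 to its difference from any other admissible control,
   and so it has the least norm. *)

theory Submission
  imports Defs
begin

section \<open>Absolutely continuous functions\<close>

lemma absolutely_continuousE:
  assumes "absolutely_continuous_on_interval a b f" "\<epsilon> > 0"
  obtains \<delta> where "\<delta> > 0" "\<And>\<D>. \<D> division_of \<Union>\<D> \<Longrightarrow> \<Union>\<D> \<subseteq> {a..b} \<Longrightarrow>
      (\<Sum>K\<in>\<D>. Sup K - Inf K) < \<delta> \<Longrightarrow> (\<Sum>K\<in>\<D>. \<bar>f (Sup K) - f (Inf K)\<bar>) < \<epsilon>"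
  using assms(1)[unfolded absolutely_continuous_on_interval_def, rule_format, OF assms(2)] that
  by (elim exE conjE) simp

text \<open>A comparison criterion that yields constants, sums and products at once: a division
  short enough for both \<open>f\<close> and \<open>g\<close> has small total increments of both,
  and the hypothesis transfers this to \<open>h\<close> interval by interval.\<close>

lemma absolutely_continuous_dominated:
  assumes f: "absolutely_continuous_on_interval a b f"
    and g: "absolutely_continuous_on_interval a b g"
    and h: "\<And>u v. a \<le> u \<Longrightarrow> u \<le> v \<Longrightarrow> v \<le> b \<Longrightarrow> \<bar>h v - h u\<bar> \<le> C * (\<bar>f v - f u\<bar> + \<bar>g v - g u\<bar>)"
  shows "absolutely_continuous_on_interval a b h"
  unfolding absolutely_continuous_on_interval_def
proof (intro allI impI)
  fix \<epsilon> :: real assume "\<epsilon> > 0"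
  \<comment> \<open>The factor 2 accounts for the two sums. The summand 1 keeps the denominator
    positive and the final inequality strict when \<open>C\<close> is 0.\<close>
  define \<eta> where "\<eta> = \<epsilon> / (2 * (\<bar>C\<bar> + 1))"
  have "\<eta> > 0" using \<open>\<epsilon> > 0\<close> by (simp add: \<eta>_def)
  obtain \<delta>1 where \<delta>1: "\<delta>1 > 0" "\<And>\<D>. \<D> division_of \<Union>\<D> \<Longrightarrow> \<Union>\<D> \<subseteq> {a..b} \<Longrightarrow>
      (\<Sum>K\<in>\<D>. Sup K - Inf K) < \<delta>1 \<Longrightarrow> (\<Sum>K\<in>\<D>. \<bar>f (Sup K) - f (Inf K)\<bar>) < \<eta>"
    using absolutely_continuousE[OF f \<open>\<eta> > 0\<close>] by blast
  obtain \<delta>2 where \<delta>2: "\<delta>2 > 0" "\<And>\<D>. \<D> division_of \<Union>\<D> \<Longrightarrow> \<Union>\<D> \<subseteq> {a..b} \<Longrightarrow>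
      (\<Sum>K\<in>\<D>. Sup K - Inf K) < \<delta>2 \<Longrightarrow> (\<Sum>K\<in>\<D>. \<bar>g (Sup K) - g (Inf K)\<bar>) < \<eta>"
    using absolutely_continuousE[OF g \<open>\<eta> > 0\<close>] by blast
  show "\<exists>\<delta>>0. \<forall>\<D>. \<D> division_of \<Union>\<D> \<and> \<Union>\<D> \<subseteq> {a..b} \<and> (\<Sum>K\<in>\<D>. Sup K - Inf K) < \<delta> \<longrightarrow>
          (\<Sum>K\<in>\<D>. \<bar>h (Sup K) - h (Inf K)\<bar>) < \<epsilon>"
  proof (intro exI[of _ "min \<delta>1 \<delta>2"] conjI allI impI)
    fix \<D> :: "real set set"
    assume \<D>: "\<D> division_of \<Union>\<D> \<and> \<Union>\<D> \<subseteq> {a..b} \<and> (\<Sum>K\<in>\<D>. Sup K - Inf K) < min \<delta>1 \<delta>2"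
    let ?F = "\<Sum>K\<in>\<D>. \<bar>f (Sup K) - f (Inf K)\<bar>" and ?G = "\<Sum>K\<in>\<D>. \<bar>g (Sup K) - g (Inf K)\<bar>"
    have "(\<Sum>K\<in>\<D>. \<bar>h (Sup K) - h (Inf K)\<bar>)
        \<le> (\<Sum>K\<in>\<D>. C * (\<bar>f (Sup K) - f (Inf K)\<bar> + \<bar>g (Sup K) - g (Inf K)\<bar>))"
    proof (rule sum_mono)
      fix K assume K: "K \<in> \<D>"
      then obtain u v where uv: "K = cbox u v" "K \<noteq> {}" "K \<subseteq> {a..b}"
        using \<D> division_ofD(3,4)[of \<D> "\<Union>\<D>"] by blast
      then have "u \<le> v" "a \<le> u" "v \<le> b" by auto
      then show "\<bar>h (Sup K) - h (Inf K)\<bar> \<le> C * (\<bar>f (Sup K) - f (Inf K)\<bar> + \<bar>g (Sup K) - g (Inf K)\<bar>)"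
        using h[of u v] uv by simp
    qed
    also have "\<dots> = C * (?F + ?G)"
      by (simp only: sum.distrib[symmetric] sum_distrib_left)
    \<comment> \<open>The sign of \<open>C\<close> is unknown, so the bounds on the two sums can be
      multiplied in only after passing to its absolute value.\<close>
    also have "\<dots> \<le> \<bar>C\<bar> * (?F + ?G)"
      by (intro mult_right_mono add_nonneg_nonneg sum_nonneg) auto
    also have "\<dots> \<le> \<bar>C\<bar> * (2 * \<eta>)"
      using \<delta>1(2)[of \<D>] \<delta>2(2)[of \<D>] \<D> by (intro mult_left_mono) auto
    also have "\<dots> < (\<bar>C\<bar> + 1) * (2 * \<eta>)"
      using \<open>\<eta> > 0\<close> by simp
    also have "\<dots> = \<epsilon>" by (simp add: \<eta>_def field_simps)
    finally show "(\<Sum>K\<in>\<D>. \<bar>h (Sup K) - h (Inf K)\<bar>) < \<epsilon>" .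
  qed (use \<delta>1 \<delta>2 in auto)
qed

lemma absolutely_continuous_ident [intro]: "absolutely_continuous_on_interval a b (\<lambda>x. x)"
  unfolding absolutely_continuous_on_interval_def
proof (intro allI impI)
  fix \<epsilon> :: real assume "\<epsilon> > 0"
  have "(\<Sum>K\<in>\<D>. \<bar>Sup K - Inf K\<bar>) = (\<Sum>K\<in>\<D>. Sup K - Inf K)"
    if \<D>: "\<D> division_of \<Union>\<D>" for \<D> :: "real set set"
  proof (rule sum.cong)
    fix K assume "K \<in> \<D>"
    then obtain u v where "K = cbox u v" "K \<noteq> {}"
      using division_ofD(3,4)[OF \<D>] by blast
    then show "\<bar>Sup K - Inf K\<bar> = Sup K - Inf K" by auto
  qed simp
  then show "\<exists>\<delta>>0. \<forall>\<D>. \<D> division_of \<Union>\<D> \<and> \<Union>\<D> \<subseteq> {a..b} \<and> (\<Sum>K\<in>\<D>. Sup K - Inf K) < \<delta> \<longrightarrow>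
          (\<Sum>K\<in>\<D>. \<bar>Sup K - Inf K\<bar>) < \<epsilon>"
    using \<open>\<epsilon> > 0\<close> by (intro exI[of _ \<epsilon>]) auto
qed

lemma absolutely_continuous_const [intro]: "absolutely_continuous_on_interval a b (\<lambda>x. c)"
  by (rule absolutely_continuous_dominated[where C = 0, OF absolutely_continuous_ident
        absolutely_continuous_ident]) simp

lemma absolutely_continuous_add [intro]:
  assumes "absolutely_continuous_on_interval a b f" "absolutely_continuous_on_interval a b g"
  shows "absolutely_continuous_on_interval a b (\<lambda>x. f x + g x)"
  by (rule absolutely_continuous_dominated[where C = 1, OF assms]) simp

text \<open>A single compact interval is already a division, and for it the defining condition reads
  as the usual epsilon-delta estimate.\<close>

lemma absolutely_continuous_imp_continuous_on:
  assumes "absolutely_continuous_on_interval a b f"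
  shows "continuous_on {a..b} f"
  unfolding continuous_on_iff
proof (intro ballI allI impI)
  fix x \<epsilon> :: real assume x: "x \<in> {a..b}" and "\<epsilon> > 0"
  then obtain \<delta> where \<delta>: "\<delta> > 0" "\<And>\<D>. \<D> division_of \<Union>\<D> \<Longrightarrow> \<Union>\<D> \<subseteq> {a..b} \<Longrightarrow>
      (\<Sum>K\<in>\<D>. Sup K - Inf K) < \<delta> \<Longrightarrow> (\<Sum>K\<in>\<D>. \<bar>f (Sup K) - f (Inf K)\<bar>) < \<epsilon>"
    using absolutely_continuousE[OF assms] by blast
  have *: "\<bar>f v - f u\<bar> < \<epsilon>" if "a \<le> u" "u \<le> v" "v \<le> b" "v - u < \<delta>" for u v
  proof -
    have "{cbox u v} division_of \<Union>{cbox u v}"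
      using division_of_self[of u v] that by simp
    then show ?thesis
      using \<delta>(2)[of "{cbox u v}"] that by simp
  qed
  show "\<exists>d>0. \<forall>y\<in>{a..b}. dist y x < d \<longrightarrow> dist (f y) (f x) < \<epsilon>"
  proof (intro exI[of _ \<delta>] conjI ballI impI)
    fix y assume "y \<in> {a..b}" "dist y x < \<delta>"
    then show "dist (f y) (f x) < \<epsilon>"
      using *[of x y] *[of y x] x by (cases "x \<le> y") (auto simp: dist_real_def abs_minus_commute)
  qed fact
qed

lemma absolutely_continuous_imp_bounded:
  assumes "absolutely_continuous_on_interval a b f"
  obtains B where "\<And>x. x \<in> {a..b} \<Longrightarrow> \<bar>f x\<bar> \<le> B"
proof -
  have "compact (f ` {a..b})"
    by (rule compact_continuous_image[OF absolutely_continuous_imp_continuous_on[OF assms]]) simp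
  then obtain B where "\<forall>y\<in>f ` {a..b}. norm y \<le> B"
    using compact_imp_bounded bounded_iff by metis
  then show ?thesis
    by (intro that[of B]) simp
qed

text \<open>The increment of the product splits into \<open>f v * (g v - g u)\<close> and
  \<open>g u * (f v - f u)\<close>. Both factors are bounded on the compact interval, so the
  comparison criterion applies.\<close>

lemma absolutely_continuous_mult [intro]:
  assumes f: "absolutely_continuous_on_interval a b f"
    and g: "absolutely_continuous_on_interval a b g"
  shows "absolutely_continuous_on_interval a b (\<lambda>x. f x * g x)"
proof -
  obtain A B where A: "\<And>x. x \<in> {a..b} \<Longrightarrow> \<bar>f x\<bar> \<le> A" and B: "\<And>x. x \<in> {a..b} \<Longrightarrow> \<bar>g x\<bar> \<le> B"
    using absolutely_continuous_imp_bounded f g by metis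
  show ?thesis
  proof (rule absolutely_continuous_dominated[where C = "max A B", OF f g])
    fix u v :: real assume "a \<le> u" "u \<le> v" "v \<le> b"
    then have "\<bar>f v\<bar> \<le> max A B" "\<bar>g u\<bar> \<le> max A B"
      using A[of v] B[of u] by auto
    have "\<bar>f v * g v - f u * g u\<bar> = \<bar>f v * (g v - g u) + g u * (f v - f u)\<bar>"
      by (simp add: algebra_simps)
    also have "\<dots> \<le> \<bar>f v\<bar> * \<bar>g v - g u\<bar> + \<bar>g u\<bar> * \<bar>f v - f u\<bar>"
      by (metis abs_mult abs_triangle_ineq)
    also have "\<dots> \<le> max A B * \<bar>g v - g u\<bar> + max A B * \<bar>f v - f u\<bar>"
      by (intro add_mono mult_right_mono) (fact | simp)+
    finally show "\<bar>f v * g v - f u * g u\<bar> \<le> max A B * (\<bar>f v - f u\<bar> + \<bar>g v - g u\<bar>)"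
      by (simp add: algebra_simps)
  qed
qed

section \<open>Divisions, tagged divisions and the fundamental theorem of calculus\<close>

text \<open>Interiors are disjoint, so the lengths add up to the measure of the union. A covering
  set of small measure thus makes a division short enough for absolute continuity to apply.\<close>

lemma sum_length_division_le_measure:
  fixes \<D> :: "real set set"
  assumes \<D>: "\<D> division_of S" and "S \<subseteq> U" "U \<in> lmeasurable"
  shows "(\<Sum>K\<in>\<D>. Sup K - Inf K) \<le> measure lebesgue U"
proof -
  have "(\<Sum>K\<in>\<D>. Sup K - Inf K) = (\<Sum>K\<in>\<D>. measure lebesgue K)"
  proof (rule sum.cong)
    fix K assume "K \<in> \<D>"
    then obtain u v where "K = cbox u v" "K \<noteq> {}"
      using division_ofD(3,4)[OF \<D>] by blast
    then show "Sup K - Inf K = measure lebesgue K" by auto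
  qed simp
  also have "\<dots> = measure lebesgue S"
    by (rule content_division[OF \<D>])
  also have "\<dots> \<le> measure lebesgue U"
    using assms lmeasurable_division[OF \<D>] by (intro measure_mono_fmeasurable) (auto simp: fmeasurableD)
  finally show ?thesis .
qed

text \<open>Absolute continuity speaks of sets of intervals, Riemann sums of sets of tagged pairs.
  Forgetting the tags is harmless: an interval carried by two different pairs has empty interior,
  and there the increment vanishes.\<close>

lemma sum_tagged_partial_division_real:
  fixes f :: "real \<Rightarrow> real"
  assumes p: "p tagged_partial_division_of S"
  shows "(\<Sum>(x,K)\<in>p. \<bar>f (Sup K) - f (Inf K)\<bar>) = (\<Sum>K\<in>snd ` p. \<bar>f (Sup K) - f (Inf K)\<bar>)"
proof -
  \<comment> \<open>The case distinction is needed because \<^term>\<open>Sup {}\<close> and \<^term>\<open>Inf {}\<close> are unspecified reals.\<close>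
  let ?d = "\<lambda>K. if K = {} then 0 else \<bar>f (Sup K) - f (Inf K)\<bar>"
  have ne: "K \<noteq> {}" if "(x,K) \<in> p" for x K
    using tagged_partial_division_ofD(2)[OF p that] by auto
  have "(\<Sum>(x,K)\<in>p. \<bar>f (Sup K) - f (Inf K)\<bar>) = (\<Sum>(x,K)\<in>p. ?d K)"
    using ne by (intro sum.cong) auto
  also have "\<dots> = (\<Sum>K\<in>snd ` p. ?d K)"
  proof (rule sum.over_tagged_division_lemma[OF tagged_partial_division_of_Union_self[OF p]])
    fix u v :: real assume "box u v = {}"
    then show "?d (cbox u v) = 0" by (cases "u = v") auto
  qed
  also have "\<dots> = (\<Sum>K\<in>snd ` p. \<bar>f (Sup K) - f (Inf K)\<bar>)"
    using ne by (intro sum.cong) auto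
  finally show ?thesis .
qed

text \<open>The straddle lemma. As \<open>x\<close> lies between \<open>u\<close> and
  \<open>v\<close>, the linearization errors \<open>e * (x - u)\<close> and
  \<open>e * (v - x)\<close> on the two sides add up to exactly \<open>e * (v - u)\<close>.\<close>

lemma has_real_derivative_straddle:
  fixes f :: "real \<Rightarrow> real"
  assumes "(f has_real_derivative D) (at x within S)" "e > 0"
  obtains d where "d > 0"
    "\<And>u v. \<lbrakk>u \<in> S; v \<in> S; u \<le> x; x \<le> v; {u..v} \<subseteq> ball x d\<rbrakk> \<Longrightarrow> \<bar>(v - u) * D - (f v - f u)\<bar> \<le> e * (v - u)"
proof -
  obtain d where d: "d > 0" "\<And>y. y \<in> S \<Longrightarrow> norm (y - x) < d \<Longrightarrow> norm (f y - f x - D * (y - x)) \<le> e * norm (y - x)"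
    using assms unfolding has_field_derivative_def has_derivative_within_alt by metis
  have "\<bar>(v - u) * D - (f v - f u)\<bar> \<le> e * (v - u)"
    if uv: "u \<in> S" "v \<in> S" "u \<le> x" "x \<le> v" "{u..v} \<subseteq> ball x d" for u v
  proof -
    have "u \<in> {u..v}" "v \<in> {u..v}" using uv by auto
    then have "u \<in> ball x d" "v \<in> ball x d" using uv(5) by blast+
    then have "\<bar>f u - f x - D * (u - x)\<bar> \<le> e * (x - u)" "\<bar>f v - f x - D * (v - x)\<bar> \<le> e * (v - x)"
      using d(2)[of u] d(2)[of v] uv by (auto simp: dist_real_def)
    moreover have "(v - u) * D - (f v - f u) = (f u - f x - D * (u - x)) - (f v - f x - D * (v - x))"
      by (simp add: algebra_simps)
    ultimately show ?thesis by (auto simp: algebra_simps)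
  qed
  then show ?thesis using that d(1) by blast
qed

text \<open>The gauge is chosen so that intervals tagged in the exceptional null set lie in an open set
  of small measure, where absolute continuity bounds the increments of the function; all other
  intervals are controlled by the derivative at their tag.\<close>

theorem fundamental_theorem_of_calculus_absolutely_continuous:
  fixes f f' :: "real \<Rightarrow> real"
  assumes "a \<le> b" and f: "absolutely_continuous_on_interval a b f" and N: "negligible N"
    and f': "\<And>x. x \<in> {a..b} - N \<Longrightarrow> (f has_real_derivative f' x) (at x within {a..b})"
  shows "(f' has_integral (f b - f a)) {a..b}"
proof (rule has_integral_spike[OF N])
  \<comment> \<open>With the value 0 on \<open>N\<close>, a term tagged in \<open>N\<close>
    contributes only the increment of \<open>f\<close> to the error.\<close>
  let ?g = "\<lambda>x. if x \<in> N then 0 else f' x"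
  show "f' x = ?g x" if "x \<in> {a..b} - N" for x using that by auto
  show "(?g has_integral (f b - f a)) {a..b}"
    unfolding has_integral_real
  proof (intro allI impI)
    fix e :: real assume "e > 0"
    \<comment> \<open>Half of the error is reserved for tags outside \<open>N\<close>, where the
      total is at most \<open>e1 * (b - a)\<close>. The summand 1 covers the case
      \<open>a = b\<close>.\<close>
    define e1 where "e1 = e / (2 * (b - a + 1))"
    have "e1 > 0" using \<open>e > 0\<close> \<open>a \<le> b\<close> by (simp add: e1_def)
    have "e / 2 > 0" using \<open>e > 0\<close> by simp
    then obtain \<delta> where \<delta>: "\<delta> > 0" "\<And>\<D>. \<D> division_of \<Union>\<D> \<Longrightarrow> \<Union>\<D> \<subseteq> {a..b} \<Longrightarrow>
        (\<Sum>K\<in>\<D>. Sup K - Inf K) < \<delta> \<Longrightarrow> (\<Sum>K\<in>\<D>. \<bar>f (Sup K) - f (Inf K)\<bar>) < e / 2"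
      using absolutely_continuousE[OF f] by blast
    obtain U where U: "open U" "N \<subseteq> U" "U \<in> lmeasurable" "measure lebesgue U < \<delta>"
    proof -
      \<comment> \<open>Outer regularity gives an open superset whose excess over \<open>N\<close>
        is small; restoring the null set \<open>N\<close> does not change the measure.\<close>
      have N0: "N \<in> null_sets lebesgue" using N by (simp add: negligible_iff_null_sets)
      then obtain U where U: "open U" "N \<subseteq> U" "U - N \<in> lmeasurable" "emeasure lebesgue (U - N) < ennreal \<delta>"
        using sets_lebesgue_outer_open[of N \<delta>] \<delta>(1) by auto
      have 1: "U \<in> lmeasurable"
        using fmeasurable.Un[OF U(3) negligible_imp_measurable[OF N]] U(2) by (simp add: Un_absorb2)
      have "emeasure lebesgue U = emeasure lebesgue (U - N)"
        using N0 1 by (simp add: emeasure_Diff_null_set fmeasurableD)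
      then have "measure lebesgue U < \<delta>"
        using U(4) 1 by (metis emeasure_eq_measure2 ennreal_less_iff measure_nonneg)
      with 1 U show ?thesis by (intro that)
    qed
    have "\<exists>d>0. (x \<in> N \<longrightarrow> ball x d \<subseteq> U) \<and>
        (x \<in> {a..b} - N \<longrightarrow> (\<forall>u\<in>{a..b}. \<forall>v\<in>{a..b}. u \<le> x \<and> x \<le> v \<and> {u..v} \<subseteq> ball x d \<longrightarrow>
           \<bar>(v - u) * f' x - (f v - f u)\<bar> \<le> e1 * (v - u)))" for x
    proof (cases "x \<in> N")
      case True
      then show ?thesis using U by (metis DiffD2 openE subsetD)
    next
      case False
      show ?thesis
      proof (cases "x \<in> {a..b}")
        case True
        with False f' have "(f has_real_derivative f' x) (at x within {a..b})" by blast
        from has_real_derivative_straddle[OF this \<open>e1 > 0\<close>] show ?thesis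
          using False by metis
      qed (use False zero_less_one in blast)
    qed
    then obtain d where d: "\<And>x. d x > 0" "\<And>x. x \<in> N \<Longrightarrow> ball x (d x) \<subseteq> U"
      "\<And>x u v. \<lbrakk>x \<in> {a..b} - N; u \<in> {a..b}; v \<in> {a..b}; u \<le> x; x \<le> v; {u..v} \<subseteq> ball x (d x)\<rbrakk> \<Longrightarrow>
           \<bar>(v - u) * f' x - (f v - f u)\<bar> \<le> e1 * (v - u)"
      by metis
    show "\<exists>\<gamma>. gauge \<gamma> \<and> (\<forall>p. p tagged_division_of {a..b} \<and> \<gamma> fine p \<longrightarrow>
        norm ((\<Sum>(x,K)\<in>p. measure lborel K *\<^sub>R ?g x) - (f b - f a)) < e)"
    proof (intro exI[of _ "\<lambda>x. ball x (d x)"] conjI allI impI)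
      show "gauge (\<lambda>x. ball x (d x))" using d(1) gauge_ball_dependent by blast
    next
      fix p assume "p tagged_division_of {a..b} \<and> (\<lambda>x. ball x (d x)) fine p"
      then have p: "p tagged_division_of {a..b}" and fine: "(\<lambda>x. ball x (d x)) fine p" by auto
      define q where "q = {(x,K) \<in> p. x \<in> N}"
      have fin: "finite p" using p by auto
      have "q \<subseteq> p" by (auto simp: q_def)
      have q: "q tagged_partial_division_of {a..b}"
        using p \<open>q \<subseteq> p\<close> by (meson tagged_division_of tagged_partial_division_subset tagged_division_of_def)
      have q_div: "snd ` q division_of \<Union>(snd ` q)"
        by (rule partial_division_of_tagged_division[OF q])
      have "\<Union>(snd ` q) \<subseteq> {a..b}"
        using tagged_partial_division_ofD(3)[OF q] by fastforce
      moreover have "\<Union>(snd ` q) \<subseteq> U"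
        using fine d(2) by (fastforce simp: q_def fine_def)
      ultimately have q_small: "(\<Sum>(x,K)\<in>q. \<bar>f (Sup K) - f (Inf K)\<bar>) < e / 2"
        unfolding sum_tagged_partial_division_real[OF q]
        using sum_length_division_le_measure[OF q_div _ U(3)] U(4) by (intro \<delta>(2)[OF q_div]) auto
      let ?h = "\<lambda>(x,K). measure lborel K *\<^sub>R ?g x - (f (Sup K) - f (Inf K))"
      have pK: "\<exists>u v. K = {u..v} \<and> u \<le> x \<and> x \<le> v \<and> a \<le> u \<and> v \<le> b" if "(x,K) \<in> p" for x K
        using tagged_division_ofD(2-4)[OF p that] by fastforce
      \<comment> \<open>The increments of \<open>f\<close> over a tagged division telescope to
        \<open>f b - f a\<close>, which distributes the error over the individual intervals.\<close>
      have "(\<Sum>(x,K)\<in>p. measure lborel K *\<^sub>R ?g x) - (f b - f a) = (\<Sum>z\<in>p. ?h z)"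
        unfolding additive_tagged_division_1[OF \<open>a \<le> b\<close> p, symmetric]
        by (simp add: sum_subtractf[symmetric] split_def)
      also have "\<dots> = (\<Sum>z\<in>p - q. ?h z) + (\<Sum>z\<in>q. ?h z)"
        using \<open>q \<subseteq> p\<close> fin by (rule sum.subset_diff)
      finally have eq: "(\<Sum>(x,K)\<in>p. measure lborel K *\<^sub>R ?g x) - (f b - f a) = (\<Sum>z\<in>p - q. ?h z) + (\<Sum>z\<in>q. ?h z)" .
      have "\<bar>\<Sum>z\<in>q. ?h z\<bar> \<le> (\<Sum>z\<in>q. \<bar>?h z\<bar>)" by (rule sum_abs)
      also have "\<dots> = (\<Sum>(x,K)\<in>q. \<bar>f (Sup K) - f (Inf K)\<bar>)"
        by (intro sum.cong) (auto simp: q_def)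
      finally have 1: "\<bar>\<Sum>z\<in>q. ?h z\<bar> < e / 2" using q_small by simp
      have "\<bar>\<Sum>z\<in>p - q. ?h z\<bar> \<le> (\<Sum>z\<in>p - q. \<bar>?h z\<bar>)" by (rule sum_abs)
      also have "\<dots> \<le> (\<Sum>(x,K)\<in>p - q. e1 * (Sup K - Inf K))"
      proof (rule sum_mono, clarify)
        fix x K assume xK: "(x,K) \<in> p" "(x,K) \<notin> q"
        then obtain u v where uv: "K = {u..v}" "u \<le> x" "x \<le> v" "a \<le> u" "v \<le> b"
          using pK by blast
        have "K \<subseteq> ball x (d x)" using fine xK(1) by (auto simp: fine_def)
        then have "\<bar>(v - u) * f' x - (f v - f u)\<bar> \<le> e1 * (v - u)"
          using uv xK by (intro d(3)) (auto simp: q_def)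
        then show "\<bar>measure lborel K *\<^sub>R ?g x - (f (Sup K) - f (Inf K))\<bar> \<le> e1 * (Sup K - Inf K)"
          using uv xK by (auto simp: q_def)
      qed
      \<comment> \<open>Putting back the nonnegative terms of \<open>q\<close> completes the
        division, so that the lengths telescope to \<open>b - a\<close>.\<close>
      also have "\<dots> \<le> (\<Sum>(x,K)\<in>p. e1 * (Sup K - Inf K))"
        using fin pK \<open>e1 > 0\<close> by (intro sum_mono2) fastforce+
      also have "\<dots> = e1 * (b - a)"
        using additive_tagged_division_1[OF \<open>a \<le> b\<close> p, of "\<lambda>x. x"]
        by (simp add: sum_distrib_left[symmetric] split_def)
      also have "\<dots> \<le> e / 2"
        using \<open>a \<le> b\<close> \<open>e > 0\<close> by (simp add: e1_def field_simps)
      finally have 2: "\<bar>\<Sum>z\<in>p - q. ?h z\<bar> \<le> e / 2" .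
      show "norm ((\<Sum>(x,K)\<in>p. measure lborel K *\<^sub>R ?g x) - (f b - f a)) < e"
        unfolding eq using 1 2 by simp
    qed
  qed
qed

section \<open>Controls\<close>

text \<open>The product is dominated by the sum of the squares, and a continuous function on a
  compact interval is square-integrable.\<close>

lemma integrable_continuous_mult_square_integrable:
  assumes \<tau>: "square_integrable_control T \<tau>" and g: "continuous_on {0..T} g"
  shows "integrable (lebesgue_on {0..T}) (\<lambda>t. g t * \<tau> t)"
proof -
  have meas: "\<tau> \<in> borel_measurable (lebesgue_on {0..T})"
    and int: "integrable (lebesgue_on {0..T}) (\<lambda>t. (\<tau> t)\<^sup>2)"
    using \<tau> by (auto simp: square_integrable_control_def)
  have g_meas: "g \<in> borel_measurable (lebesgue_on {0..T})"
    by (rule continuous_imp_measurable_on_sets_lebesgue[OF g]) simp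
  have "integrable (lebesgue_on {0..T}) (\<lambda>t. (g t)\<^sup>2)"
    by (intro continuous_imp_integrable_real continuous_intros g)
  then have "integrable (lebesgue_on {0..T}) (\<lambda>t. (g t)\<^sup>2 + (\<tau> t)\<^sup>2)"
    using int by (rule Bochner_Integration.integrable_add)
  then show ?thesis
  proof (rule Bochner_Integration.integrable_bound)
    have "\<bar>x * y\<bar> \<le> x\<^sup>2 + y\<^sup>2" for x y :: real
    proof -
      have "2 * \<bar>x * y\<bar> \<le> x\<^sup>2 + y\<^sup>2"
        using sum_squares_bound[of "\<bar>x\<bar>" "\<bar>y\<bar>"] by (simp add: abs_mult)
      then show ?thesis using abs_ge_zero[of "x * y"] by linarith
    qed
    then show "AE t in lebesgue_on {0..T}. norm (g t * \<tau> t) \<le> norm ((g t)\<^sup>2 + (\<tau> t)\<^sup>2)"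
      by simp
  qed (use meas g_meas in measurable)
qed

text \<open>The endpoint conditions prescribe the moments of the torque of orders zero and one:
  \<open>a = 1\<close>, \<open>b = 0\<close> gives the change of momentum, and \<open>a = 0\<close>,
  \<open>b = 1\<close> involves the change of orientation.\<close>

lemma admissible_control_affine_moment:
  assumes "T > 0" "I \<noteq> 0" and \<tau>: "admissible_control I T (\<sigma>\<^sub>0, p\<^sub>0) (\<sigma>\<^sub>1, p\<^sub>1) \<tau>"
  shows "(LINT t|lebesgue_on {0..T}. (a + b * t) * \<tau> t)
    = (a + b * T) * p\<^sub>1 - a * p\<^sub>0 - b * I * (\<sigma>\<^sub>1 - \<sigma>\<^sub>0)"
proof -
  obtain \<sigma> p where \<sigma>: "absolutely_continuous_on_interval 0 T \<sigma>"
    and p: "absolutely_continuous_on_interval 0 T p"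
    and ae: "AE t in lebesgue_on {0..T}. (\<sigma> has_real_derivative p t / I) (at t within {0..T}) \<and>
        (p has_real_derivative \<tau> t) (at t within {0..T})"
    and bc: "\<sigma> 0 = \<sigma>\<^sub>0" "p 0 = p\<^sub>0" "\<sigma> T = \<sigma>\<^sub>1" "p T = p\<^sub>1"
    and sq: "square_integrable_control T \<tau>"
    using \<tau> by (auto simp: admissible_control_def body_solution_def)
  obtain N where N: "N \<in> null_sets lebesgue"
    and d: "\<And>t. t \<in> {0..T} - N \<Longrightarrow> (\<sigma> has_real_derivative p t / I) (at t within {0..T}) \<and>
        (p has_real_derivative \<tau> t) (at t within {0..T})"
  proof -
    \<comment> \<open>The fundamental theorem takes an explicit negligible exceptional set, so the
      almost-everywhere statement is moved from the restricted measure to the whole line.\<close>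
    have "AE t in lebesgue. t \<in> {0..T} \<longrightarrow> (\<sigma> has_real_derivative p t / I) (at t within {0..T}) \<and>
        (p has_real_derivative \<tau> t) (at t within {0..T})"
      using ae by (subst (asm) AE_restrict_space_iff) simp_all
    then obtain N where "N \<in> null_sets lebesgue"
      "{t \<in> space lebesgue. \<not> (t \<in> {0..T} \<longrightarrow> (\<sigma> has_real_derivative p t / I) (at t within {0..T}) \<and>
        (p has_real_derivative \<tau> t) (at t within {0..T}))} \<subseteq> N"
      unfolding eventually_ae_filter by blast
    then show ?thesis by (intro that[of N]) auto
  qed
  \<comment> \<open>The product rule leaves a term \<open>b * p t\<close>; the multiple of
    \<open>\<sigma>\<close> is chosen to cancel it, since \<open>I\<close> times the derivative of
    \<open>\<sigma>\<close> is \<open>p\<close>.\<close>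
  let ?h = "\<lambda>t. (a + b * t) * p t + - (b * I) * \<sigma> t"
  have "((\<lambda>t. (a + b * t) * \<tau> t) has_integral (?h T - ?h 0)) {0..T}"
  proof (rule fundamental_theorem_of_calculus_absolutely_continuous)
    show "absolutely_continuous_on_interval 0 T ?h"
      using \<sigma> p by (intro absolutely_continuous_add absolutely_continuous_mult
          absolutely_continuous_const absolutely_continuous_ident)
    show "negligible N" using N by (simp add: negligible_iff_null_sets)
    fix t assume "t \<in> {0..T} - N"
    then have "(\<sigma> has_real_derivative p t / I) (at t within {0..T})"
        "(p has_real_derivative \<tau> t) (at t within {0..T})"
      using d by auto
    then show "(?h has_real_derivative (a + b * t) * \<tau> t) (at t within {0..T})"
      using \<open>I \<noteq> 0\<close> by (auto intro!: derivative_eq_intros)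
  qed (use \<open>T > 0\<close> in simp)
  \<comment> \<open>Integrability makes the Lebesgue integral a gauge integral too, and uniqueness
    identifies it with the boundary terms.\<close>
  moreover have "((\<lambda>t. (a + b * t) * \<tau> t) has_integral
      (LINT t|lebesgue_on {0..T}. (a + b * t) * \<tau> t)) {0..T}"
    by (intro has_integral_integral_lebesgue_on integrable_continuous_mult_square_integrable[OF sq]
        continuous_intros) simp
  ultimately have "(LINT t|lebesgue_on {0..T}. (a + b * t) * \<tau> t) = ?h T - ?h 0"
    by (rule has_integral_unique[rotated])
  then show ?thesis by (simp add: bc algebra_simps)
qed

section \<open>Optimality and admissibility of affine controls\<close>

text \<open>By orthogonality the excess cost of \<open>\<tau>\<close> is exactly the integral of
  \<open>(\<tau> t - (a + b * t))\<^sup>2\<close>.\<close>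

lemma affine_control_optimal:
  assumes "T > 0" "I \<noteq> 0"
    and affine: "admissible_control I T (\<sigma>\<^sub>0, p\<^sub>0) (\<sigma>\<^sub>1, p\<^sub>1) (\<lambda>t. a + b * t)"
    and \<tau>: "admissible_control I T (\<sigma>\<^sub>0, p\<^sub>0) (\<sigma>\<^sub>1, p\<^sub>1) \<tau>"
  shows "control_cost T (\<lambda>t. a + b * t) \<le> control_cost T \<tau>"
proof -
  let ?M = "lebesgue_on {0..T}" and ?u = "\<lambda>t. a + b * t"
  have sq: "square_integrable_control T \<tau>" and sq_u: "square_integrable_control T ?u"
    using \<tau> affine by (auto simp: admissible_control_def)
  have int: "integrable ?M (\<lambda>t. (\<tau> t)\<^sup>2)" "integrable ?M (\<lambda>t. (?u t)\<^sup>2)"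
    using sq sq_u by (auto simp: square_integrable_control_def)
  have int': "integrable ?M (\<lambda>t. ?u t * \<tau> t)"
    by (intro integrable_continuous_mult_square_integrable[OF sq] continuous_intros)
  \<comment> \<open>Both controls share the boundary data, hence the moment against
    \<open>a + b * t\<close>; for the affine control this moment is its own cost.\<close>
  have orth: "(LINT t|?M. ?u t * \<tau> t) = control_cost T ?u"
    using admissible_control_affine_moment[OF assms(1,2) \<tau>, of a b]
      admissible_control_affine_moment[OF assms(1,2) affine, of a b]
    by (simp add: control_cost_def power2_eq_square)
  have "0 \<le> (LINT t|?M. (\<tau> t - ?u t)\<^sup>2)"
    by simp
  also have "\<dots> = (LINT t|?M. (\<tau> t)\<^sup>2 - 2 * (?u t * \<tau> t) + (?u t)\<^sup>2)"
    by (intro Bochner_Integration.integral_cong) (auto simp: power2_eq_square algebra_simps)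
  also have "\<dots> = control_cost T \<tau> - 2 * (LINT t|?M. ?u t * \<tau> t) + control_cost T ?u"
    using int int' by (simp add: control_cost_def del: distrib_left)
  finally show ?thesis using orth by simp
qed

text \<open>Integrating the torque twice gives a quadratic momentum and a cubic orientation; the two
  equations assumed are their values at \<open>T\<close>.\<close>

lemma admissible_control_affine:
  assumes "I \<noteq> 0"
    and p1: "p\<^sub>1 = p\<^sub>0 + a * T + b * T\<^sup>2 / 2"
    and \<sigma>1: "\<sigma>\<^sub>1 = \<sigma>\<^sub>0 + (p\<^sub>0 * T + a * T\<^sup>2 / 2 + b * T ^ 3 / 6) / I"
  shows "admissible_control I T (\<sigma>\<^sub>0, p\<^sub>0) (\<sigma>\<^sub>1, p\<^sub>1) (\<lambda>t. a + b * t)"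
proof -
  \<comment> \<open>Horner form lets absolute continuity follow from closure under sums and products
    alone.\<close>
  let ?p = "\<lambda>t. p\<^sub>0 + t * (a + t * (b / 2))"
  let ?\<sigma> = "\<lambda>t. \<sigma>\<^sub>0 + t * (p\<^sub>0 / I + t * (a / (2 * I) + t * (b / (6 * I))))"
  have "square_integrable_control T (\<lambda>t. a + b * t)"
    unfolding square_integrable_control_def
    by (intro conjI continuous_imp_measurable_on_sets_lebesgue continuous_imp_integrable_real
        continuous_intros) simp
  moreover have "body_solution I T (\<lambda>t. a + b * t) (\<sigma>\<^sub>0, p\<^sub>0) ?\<sigma> ?p"
    unfolding body_solution_def
  proof (intro conjI AE_I2)
    show "absolutely_continuous_on_interval 0 T ?\<sigma>" "absolutely_continuous_on_interval 0 T ?p"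
      by (intro absolutely_continuous_add absolutely_continuous_mult
          absolutely_continuous_const absolutely_continuous_ident)+
    show "(?\<sigma> has_real_derivative ?p t / I) (at t within {0..T})" for t
      by (rule derivative_eq_intros refl | use \<open>I \<noteq> 0\<close> in \<open>simp add: field_simps\<close>)+
    show "(?p has_real_derivative a + b * t) (at t within {0..T})" for t
      by (rule derivative_eq_intros refl | simp add: field_simps)+
  qed simp
  moreover have "?\<sigma> T = \<sigma>\<^sub>1" "?p T = p\<^sub>1"
    using \<open>I \<noteq> 0\<close> by (simp_all add: p1 \<sigma>1 field_simps power2_eq_square power3_eq_cube)
  ultimately show ?thesis
    unfolding admissible_control_def by blast
qed

theorem mainTheorem3:
  fixes I T\<^sub>k \<sigma>\<^sub>k p\<^sub>k \<sigma>\<^sub>k' p\<^sub>k' :: real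
  assumes "I > 0" and "T\<^sub>k > 0"
  defines "\<tau>\<^sub>k \<equiv> stance_torque I T\<^sub>k \<sigma>\<^sub>k p\<^sub>k \<sigma>\<^sub>k' p\<^sub>k'"
  shows "admissible_control I T\<^sub>k (\<sigma>\<^sub>k, p\<^sub>k) (\<sigma>\<^sub>k', p\<^sub>k') \<tau>\<^sub>k \<and>
    (\<forall>\<tau>. admissible_control I T\<^sub>k (\<sigma>\<^sub>k, p\<^sub>k) (\<sigma>\<^sub>k', p\<^sub>k') \<tau> \<longrightarrow>
      control_cost T\<^sub>k \<tau>\<^sub>k \<le> control_cost T\<^sub>k \<tau>)"
proof -
  \<comment> \<open>These are the intercept and the slope of the affine torque.\<close>
  define a b where "a = stance_A2 I T\<^sub>k \<sigma>\<^sub>k p\<^sub>k \<sigma>\<^sub>k' p\<^sub>k' / 2"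
    and "b = - stance_A1 I T\<^sub>k \<sigma>\<^sub>k p\<^sub>k \<sigma>\<^sub>k' p\<^sub>k' / (2 * I)"
  have \<tau>\<^sub>k: "\<tau>\<^sub>k = (\<lambda>t. a + b * t)"
    by (auto simp: \<tau>\<^sub>k_def a_def b_def stance_torque_def field_simps)
  \<comment> \<open>With the second equation multiplied by \<open>I\<close>, this is a linear system
    for \<open>a\<close> and \<open>b\<close> with determinant \<open>- T\<^sub>k ^ 4 / 12\<close>,
    and the stated coefficients are its solution. Substitution verifies it.\<close>
  have "p\<^sub>k' = p\<^sub>k + a * T\<^sub>k + b * T\<^sub>k\<^sup>2 / 2"
    "\<sigma>\<^sub>k' = \<sigma>\<^sub>k + (p\<^sub>k * T\<^sub>k + a * T\<^sub>k\<^sup>2 / 2 + b * T\<^sub>k ^ 3 / 6) / I"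
    using assms(1,2)
    by (simp_all add: a_def b_def stance_A1_def stance_A2_def field_simps power2_eq_square
        power3_eq_cube)
  then have adm: "admissible_control I T\<^sub>k (\<sigma>\<^sub>k, p\<^sub>k) (\<sigma>\<^sub>k', p\<^sub>k') (\<lambda>t. a + b * t)"
    using \<open>I > 0\<close> by (intro admissible_control_affine) auto
  then show ?thesis
    unfolding \<tau>\<^sub>k using affine_control_optimal[OF \<open>T\<^sub>k > 0\<close> _ adm] \<open>I > 0\<close> by auto
qed

end
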